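(* Let $d$ be a positive integer. Suppose that $(\tau,s)$ is a John-Strömberg pair for $\mathcal{Q}(\mathbb{R}^{d})$. Then $$0<s\le 1/2$$ and, for each $\theta\in(0,s/(1-s))$, the pair $\left((1-\theta)\tau,\; s-\theta(1-s)\right)$ is also a John-Strömberg pair for $\mathcal{Q}(\mathbb{R}^{d})$.
   Context: A cube in $\mathbb{R}^d$ means a closed cube with sides parallel to the axes, i.e. a cartesian product of $d$ bounded closed intervals, all of the same positive length. $\mathcal{Q}(\mathbb{R}^{d})$ denotes the collection of all cubes in $\mathbb{R}^{d}$, and $\lambda$ denotes $d$-dimensional Lebesgue measure. John-Strömberg pair: an ordered pair $(\tau,s)$ of positive real numbers is a John-Strömberg pair for $\mathcal{Q}(\mathbb{R}^{d})$ if it has the following property. Let $Q$ be an arbitrary cube in $\mathbb{R}^d$ and let $E_{+}$ and $E_{-}$ be arbitrary disjoint Lebesgue measurable subsets of $Q$ satisfying $\min\{\lambda(E_{+}),\lambda(E_{-})\}>\tau\lambda(Q\setminus E_{+}\setminus E_{-})$. Then there exists a cube $W\subset Q$ for which $\min\{\lambda(E_{+}\cap W),\lambda(E_{-}\cap W)\}\ge s\lambda(W)$. *)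

theory Defs
  imports "HOL-Analysis.Analysis"
begin

definition cubes :: "(real ^ 'd) set set" where
  "cubes = {cbox a b |a b. \<exists>l>0. \<forall>i. b $ i - a $ i = l}"

(* All sets whose measure is taken below are subsets of the cube Q, hence of finite
   Lebesgue measure, so the real-valued measure loses no information. *)
definition John_Stromberg_pair :: "(real ^ 'd) set set \<Rightarrow> real \<times> real \<Rightarrow> bool" where
  "John_Stromberg_pair \<Q> = (\<lambda>(\<tau>, s). \<tau> > 0 \<and> s > 0 \<and>
     (\<forall>Q\<in>\<Q>. \<forall>E\<^sub>p\<in>sets lebesgue. \<forall>E\<^sub>m\<in>sets lebesgue.
        E\<^sub>p \<subseteq> Q \<longrightarrow> E\<^sub>m \<subseteq> Q \<longrightarrow> E\<^sub>p \<inter> E\<^sub>m = {} \<longrightarrow>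
        min (measure lebesgue E\<^sub>p) (measure lebesgue E\<^sub>m) > \<tau> * measure lebesgue (Q - E\<^sub>p - E\<^sub>m) \<longrightarrow>
        (\<exists>W\<in>\<Q>. W \<subseteq> Q \<and>
           min (measure lebesgue (E\<^sub>p \<inter> W)) (measure lebesgue (E\<^sub>m \<inter> W)) \<ge> s * measure lebesgue W)))"

end

theory Submission
  imports Defs
begin

text \<open>
  Splitting a cube into two halves of equal measure shows \<open>s \<le> 1/2\<close>. For the improvement, inner
  regularity replaces the two sets and the remainder of the cube by disjoint compact sets
  \<open>E\<close>, \<open>F\<close>, \<open>S\<close>. Move to \<open>E\<close> a part \<open>A\<close> of \<open>S\<close> of relative measure \<open>\<theta>\<close>, equidistributed in \<open>S\<close> at
  a very small scale, and apply the given pair to \<open>E \<union> A\<close> and \<open>F\<close>. The resulting cube \<open>W\<close> meets both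
  of these compact sets, so its side is bounded below and \<open>A\<close> fills, up to a small error, only the
  fraction \<open>\<theta>\<close> of \<open>S \<inter> W\<close>, which has measure at most \<open>(1 - s) \<lambda>(W) - \<lambda>(E \<inter> W)\<close>. This gives
  \<open>(1 - \<theta>) \<lambda>(E \<inter> W) \<ge> (s - \<theta> (1 - s)) \<lambda>(W)\<close> up to the error, and the factor \<open>1 - \<theta>\<close> leaves room
  to absorb it.
\<close>

section \<open>Subsets of prescribed measure, and their equidistribution\<close>

text \<open>Cut \<open>S\<close> by the half-spaces \<open>x $ k \<le> t\<close>. Since
  \<open>S\<close> lies in a box, the measure of the cut is Lipschitz in \<open>t\<close>, and it
  runs from 0 to the full measure, so the intermediate value theorem yields
  \<open>A\<close>.\<close>

lemma lmeasurable_subset_of_measure: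
  fixes S :: "(real ^ 'd) set"
  assumes "bounded S" "S \<in> lmeasurable" "0 \<le> \<theta>" "\<theta> \<le> 1"
  obtains A where "A \<subseteq> S" "A \<in> lmeasurable" "measure lebesgue A = \<theta> * measure lebesgue S"
proof -
  obtain k :: 'd where True by simp
  obtain B where B: "B > 0" "\<And>x. x \<in> S \<Longrightarrow> norm x < B"
    using assms(1) bounded_pos_less by blast
  then have xB: "- B < x $ i \<and> x $ i < B" if "x \<in> S" for x i
    using component_le_norm_cart[of x i] that by fastforce
  define H where "H t = S \<inter> {x. x $ k \<le> t}" for t
  define f where "f t = measure lebesgue (H t)" for t
  define C where "C = (\<Prod>i\<in>UNIV - {k}. 2 * B)"
  have H: "H t \<in> lmeasurable" for t
    unfolding H_def by (intro fmeasurable_Int_fmeasurable assms) (simp add: closed_halfspace_component_le_cart borel_closed)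
  have step: "f t \<le> f t'" "f t' - f t \<le> C * (t' - t)" if "t \<le> t'" for t t'
  proof -
    have sub: "H t \<subseteq> H t'" using that by (auto simp: H_def)
    show "f t \<le> f t'"
      unfolding f_def using sub H by (intro measure_mono_fmeasurable) auto
    \<comment> \<open>The slab between the levels \<open>t\<close> and \<open>t'\<close> lies in
      this box: side \<open>t' - t\<close> in direction \<open>k\<close> and \<open>2 * B\<close> in
      every other, which gives the Lipschitz constant \<open>C\<close>.\<close>
    define a b where "a = (\<chi> i. if i = k then t else - B)" and "b = (\<chi> i. if i = k then t' else B)"
    have ne: "cbox a b \<noteq> {}"
      using that B(1) by (auto simp: interval_eq_empty_cart a_def b_def)
    have "f t' - f t = measure lebesgue (H t' - H t)"
      unfolding f_def using sub H by (simp add: measurable_measure_Diff)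
    also have "\<dots> \<le> measure lebesgue (cbox a b)"
      using H xB by (intro measure_mono_fmeasurable)
        (force simp: mem_box_cart a_def b_def H_def intro: less_imp_le)+
    also have "\<dots> = (t' - t) * C"
    proof -
      have "measure lebesgue (cbox a b) = (\<Prod>i\<in>UNIV. b $ i - a $ i)"
        using content_cbox_cart[OF ne] by simp
      also have "\<dots> = (b $ k - a $ k) * (\<Prod>i\<in>UNIV - {k}. b $ i - a $ i)"
        by (simp add: prod.remove)
      also have "(\<Prod>i\<in>UNIV - {k}. b $ i - a $ i) = C"
        unfolding C_def by (rule prod.cong) (auto simp: a_def b_def)
      finally show ?thesis by (simp add: a_def b_def)
    qed
    finally show "f t' - f t \<le> C * (t' - t)" by (simp add: mult.commute)
  qed
  have "C-lipschitz_on UNIV f"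
  proof (rule lipschitz_onI)
    show "dist (f x) (f y) \<le> C * dist x y" for x y
      using step[of x y] step[of y x] by (cases "x \<le> y") (auto simp: dist_real_def)
    show "0 \<le> C" using B(1) by (auto simp: C_def intro: prod_nonneg)
  qed
  then have cont: "continuous_on {-B..B} f"
    using lipschitz_on_continuous_on continuous_on_subset by blast
  \<comment> \<open>The bound \<open>B\<close> is strict, so the lowest cut is empty.\<close>
  have "H (-B) = {}" "H B = S"
    using xB[of _ k] by (force simp: H_def)+
  then have "f (-B) = 0" "f B = measure lebesgue S"
    by (simp_all add: f_def)
  moreover have "\<theta> * measure lebesgue S \<le> measure lebesgue S"
    using assms(4) by (simp add: mult_left_le_one_le assms(3))
  ultimately obtain t where "f t = \<theta> * measure lebesgue S"
    using IVT'[OF _ _ _ cont, of "\<theta> * measure lebesgue S"] B(1) assms(3) by auto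
  then show ?thesis
    using that[of "H t"] H by (auto simp: f_def H_def)
qed

text \<open>Cover \<open>S\<close> by finitely many balls of radius \<open>\<eta>/2\<close>, which
  cuts it into pieces of diameter less than \<open>\<eta>\<close>, and take the fraction
  \<open>\<theta>\<close> of each piece. A piece that meets \<open>W\<close> lies wholly in
  \<open>U\<close>, so summing over the pieces bounds \<open>A \<inter> W\<close>. The scale
  \<open>\<eta>\<close> is fixed first; \<open>A\<close> then serves all \<open>W\<close> and
  \<open>U\<close> at once.\<close>

lemma equidistributed_subset:
  fixes S :: "(real ^ 'd) set"
  assumes "bounded S" "S \<in> lmeasurable" "0 \<le> \<theta>" "\<theta> \<le> 1" "\<eta> > 0"
  obtains A where "A \<subseteq> S" "A \<in> lmeasurable" "measure lebesgue A = \<theta> * measure lebesgue S"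
    "\<And>W U. W \<in> lmeasurable \<Longrightarrow> U \<in> lmeasurable \<Longrightarrow> (\<And>x. x \<in> W \<Longrightarrow> ball x \<eta> \<subseteq> U) \<Longrightarrow>
      measure lebesgue (A \<inter> W) \<le> \<theta> * measure lebesgue (S \<inter> U)"
proof -
  have "compact (closure S)"
    using assms(1) by simp
  from seq_compact_imp_totally_bounded[OF compact_imp_seq_compact[OF this], rule_format, of "\<eta>/2"]
  obtain I where "finite I" and cover: "closure S \<subseteq> (\<Union>c\<in>I. ball c (\<eta>/2))"
    using \<open>\<eta> > 0\<close> by auto
  have "S \<subseteq> (\<Union>c\<in>I. ball c (\<eta>/2))"
    using cover closure_subset by blast
  with \<open>finite I\<close> assms(1,2) have "\<exists>A\<subseteq>S. A \<in> lmeasurable \<and> measure lebesgue A = \<theta> * measure lebesgue S \<and>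
    (\<forall>W U. W \<in> lmeasurable \<longrightarrow> U \<in> lmeasurable \<longrightarrow> (\<forall>x\<in>W. ball x \<eta> \<subseteq> U) \<longrightarrow>
      measure lebesgue (A \<inter> W) \<le> \<theta> * measure lebesgue (S \<inter> U))"
  \<comment> \<open>One ball is split off at a time. The induction hypothesis is applied to the part
    of \<open>S\<close> outside it, so \<open>S\<close> has to vary.\<close>
  proof (induction I arbitrary: S)
    case empty
    then show ?case by auto
  next
    case (insert c I)
    define P where "P = S \<inter> ball c (\<eta>/2)"
    define R where "R = S - ball c (\<eta>/2)"
    have P: "P \<in> lmeasurable" "bounded P" and R: "R \<in> lmeasurable" "bounded R"
      unfolding P_def R_def using insert.prems by (auto intro: fmeasurable.Diff bounded_subset)
    have split: "measure lebesgue (S \<inter> U) = measure lebesgue (P \<inter> U) + measure lebesgue (R \<inter> U)"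
      if "U \<in> sets lebesgue" for U
    proof -
      have "S \<inter> U = (P \<inter> U) \<union> (R \<inter> U)" by (auto simp: P_def R_def)
      then show ?thesis
        using P R that
        by (auto simp: P_def R_def fmeasurable_Int_fmeasurable intro!: measure_Un_AE)
    qed
    obtain A0 where A0: "A0 \<subseteq> P" "A0 \<in> lmeasurable" "measure lebesgue A0 = \<theta> * measure lebesgue P"
      using lmeasurable_subset_of_measure[OF P(2,1) assms(3,4)] by blast
    have "R \<subseteq> (\<Union>c\<in>I. ball c (\<eta>/2))"
      using insert.prems(3) by (auto simp: R_def)
    from insert.IH[OF R(2,1) this] obtain A1 where A1: "A1 \<subseteq> R" "A1 \<in> lmeasurable"
      "measure lebesgue A1 = \<theta> * measure lebesgue R"
      "\<And>W U. W \<in> lmeasurable \<Longrightarrow> U \<in> lmeasurable \<Longrightarrow> \<forall>x\<in>W. ball x \<eta> \<subseteq> U \<Longrightarrow>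
        measure lebesgue (A1 \<inter> W) \<le> \<theta> * measure lebesgue (R \<inter> U)"
      by metis
    have disj: "A0 \<inter> A1 = {}" using A0 A1 by (auto simp: P_def R_def)
    show ?case
    proof (intro exI[of _ "A0 \<union> A1"] conjI allI impI)
      show "A0 \<union> A1 \<subseteq> S" using A0 A1 by (auto simp: P_def R_def)
      show "A0 \<union> A1 \<in> lmeasurable" using A0 A1 by auto
      have "measure lebesgue (A0 \<union> A1) = measure lebesgue A0 + measure lebesgue A1"
        using A0 A1 disj by (intro measure_Un_AE) auto
      then show "measure lebesgue (A0 \<union> A1) = \<theta> * measure lebesgue S"
        using A0 A1 split[of UNIV] by (simp add: distrib_left)
      fix W U :: "(real ^ 'd) set" assume W: "W \<in> lmeasurable" and U: "U \<in> lmeasurable" and WU: "\<forall>x\<in>W. ball x \<eta> \<subseteq> U"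
      have "measure lebesgue (A0 \<inter> W) \<le> \<theta> * measure lebesgue (P \<inter> U)"
      proof (cases "P \<inter> W = {}")
        case True
        then have "A0 \<inter> W = {}" using A0 by auto
        then show ?thesis using assms(3) by simp
      next
        case False
        then obtain x where x: "x \<in> W" "dist c x < \<eta>/2" by (auto simp: P_def)
        \<comment> \<open>Any two points of \<open>P\<close> are at distance less than
          \<open>\<eta>\<close> through the centre \<open>c\<close>, so one point of
          \<open>P\<close> in \<open>W\<close> forces all of \<open>P\<close> into
          \<open>U\<close>.\<close>
        have "P \<subseteq> ball x \<eta>"
        proof
          fix y assume "y \<in> P"
          then have "dist c y < \<eta>/2" by (simp add: P_def)
          with x show "y \<in> ball x \<eta>"
            using dist_triangle[of x y c] by (simp add: dist_commute)
        qed
        then have "P \<inter> U = P" using WU x by blast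
        then show ?thesis
          using measure_mono_fmeasurable[of "A0 \<inter> W" A0 lebesgue] A0 W by auto
      qed
      moreover have "measure lebesgue ((A0 \<union> A1) \<inter> W) = measure lebesgue (A0 \<inter> W) + measure lebesgue (A1 \<inter> W)"
        unfolding Int_Un_distrib2 using A0 A1 disj W by (intro measure_Un_AE) auto
      ultimately show "measure lebesgue ((A0 \<union> A1) \<inter> W) \<le> \<theta> * measure lebesgue (S \<inter> U)"
        using A1(4)[OF W U WU] split[of U] U by (simp add: distrib_left)
    qed
  qed
  then show ?thesis using that by metis
qed

section \<open>Compact approximation, access to the definitions, and the bound
  \<open>s \<le> 1/2\<close>\<close>

lemma lmeasurable_inner_compact:
  fixes S :: "(real ^ 'd) set"
  assumes "bounded S" "S \<in> sets lebesgue" "e > 0"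
  obtains K where "compact K" "K \<subseteq> S" "measure lebesgue S - e < measure lebesgue K"
proof -
  obtain K where K: "closed K" "K \<subseteq> S" "S - K \<in> lmeasurable" "emeasure lebesgue (S - K) < ennreal e"
    using sets_lebesgue_inner_closed assms by blast
  have cK: "compact K"
    using K assms(1) bounded_subset compact_eq_bounded_closed by blast
  have "measure lebesgue (S - K) < e"
    using K(3,4) assms(3) by (simp add: emeasure_eq_measure2 ennreal_less_iff)
  moreover have "measure lebesgue (S - K) = measure lebesgue S - measure lebesgue K"
    using K cK assms by (intro measurable_measure_Diff) (auto simp: lmeasurable_compact bounded_set_imp_lmeasurable)
  ultimately show ?thesis using that[OF cK K(2)] by simp
qed

lemma cubesE:
  fixes Q :: "(real ^ 'd) set"
  assumes "Q \<in> cubes"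
  obtains a b l where "Q = cbox a b" "l > 0" "\<And>i. b $ i - a $ i = l"
    "measure lebesgue Q = l ^ CARD('d)"
proof -
  obtain a b l where *: "Q = cbox a b" "l > 0" "\<And>i. b $ i - a $ i = l"
    using assms by (auto simp: cubes_def)
  have "a $ i \<le> b $ i" for i
    using *(2) *(3)[of i] by linarith
  then have "cbox a b \<noteq> {}"
    by (simp add: interval_eq_empty_cart not_less)
  then show ?thesis
    using that[OF *] by (simp add: content_cbox_cart *)
qed

lemma John_Stromberg_pairD:
  assumes "John_Stromberg_pair \<Q> (\<tau>, s)" "Q \<in> \<Q>" "E \<in> sets lebesgue" "F \<in> sets lebesgue"
    "E \<subseteq> Q" "F \<subseteq> Q" "E \<inter> F = {}"
    "measure lebesgue E > \<tau> * measure lebesgue (Q - E - F)"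
    "measure lebesgue F > \<tau> * measure lebesgue (Q - E - F)"
  obtains W where "W \<in> \<Q>" "W \<subseteq> Q" "measure lebesgue (E \<inter> W) \<ge> s * measure lebesgue W"
    "measure lebesgue (F \<inter> W) \<ge> s * measure lebesgue W"
proof -
  have "\<exists>W\<in>\<Q>. W \<subseteq> Q \<and>
      s * measure lebesgue W \<le> min (measure lebesgue (E \<inter> W)) (measure lebesgue (F \<inter> W))"
    using assms(1)[unfolded John_Stromberg_pair_def split_conv, THEN conjunct2, THEN conjunct2,
        rule_format, OF assms(2-7)] assms(8,9) by simp
  then show ?thesis
    using that by auto
qed

text \<open>Two complementary halves of the unit cube leave no remainder, so the size condition
  holds whatever \<open>\<tau>\<close> is. The cube \<open>W\<close> obtained is the disjoint union
  of its parts in the two halves, each of measure at least \<open>s\<close> times its own.\<close>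

lemma John_Stromberg_pair_le_half:
  assumes "John_Stromberg_pair (cubes :: (real ^ 'd) set set) (\<tau>, s)"
  shows "s \<le> 1 / 2"
proof -
  define Q :: "(real ^ 'd) set" where "Q = cbox 0 1"
  have Q: "Q \<in> cubes"
    unfolding Q_def cubes_def by (intro CollectI exI[of _ 0] exI[of _ 1]) simp
  have ne: "cbox 0 (1::real ^ 'd) \<noteq> {}"
    by (simp add: interval_eq_empty_cart not_less)
  have mQ: "measure lebesgue Q = 1" "Q \<in> lmeasurable" "bounded Q"
    unfolding Q_def by (simp_all add: content_cbox_cart[OF ne])
  obtain A where A: "A \<subseteq> Q" "A \<in> lmeasurable" "measure lebesgue A = 1 / 2 * measure lebesgue Q"
    using lmeasurable_subset_of_measure[OF mQ(3,2), of "1/2"] by auto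
  have "measure lebesgue (Q - A) = 1 / 2"
    using A mQ by (subst measurable_measure_Diff) auto
  moreover have "Q - A - (Q - A) = {}" by auto
  ultimately obtain W where W: "W \<in> cubes" "W \<subseteq> Q"
      "measure lebesgue (A \<inter> W) \<ge> s * measure lebesgue W"
      "measure lebesgue ((Q - A) \<inter> W) \<ge> s * measure lebesgue W"
    using John_Stromberg_pairD[OF assms Q, of A "Q - A"] A mQ by auto
  obtain a b l where l: "W = cbox a b" "l > 0" "measure lebesgue W = l ^ CARD('d)"
    using cubesE[OF W(1)] by metis
  have "W = (A \<inter> W) \<union> ((Q - A) \<inter> W)" using W(2) by auto
  moreover have "measure lebesgue ((A \<inter> W) \<union> ((Q - A) \<inter> W)) =
      measure lebesgue (A \<inter> W) + measure lebesgue ((Q - A) \<inter> W)"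
    using A mQ l(1) by (intro measure_Un_AE) (auto intro: fmeasurable.Diff)
  ultimately have "2 * s * measure lebesgue W \<le> 1 * measure lebesgue W"
    using W(3,4) by simp
  then show ?thesis
    using l(2,3) by (simp del: mult_1)
qed

section \<open>Size and enlargement of cubes\<close>

text \<open>The Euclidean norm is at most the sum of the absolute coordinates, and each coordinate
  difference inside the cube is at most \<open>l\<close>. This excludes small cubes that meet two
  separated sets.\<close>

lemma cube_meeting_separated_sets:
  fixes a b :: "real ^ 'd"
  assumes "\<And>i. b $ i - a $ i = l" "x \<in> cbox a b" "y \<in> cbox a b" "\<delta> \<le> dist x y"
  shows "\<delta> / CARD('d) \<le> l"
proof -
  have "dist x y \<le> (\<Sum>i\<in>UNIV. \<bar>(x - y) $ i\<bar>)"
    unfolding dist_norm by (rule norm_le_l1_cart)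
  also have "\<dots> \<le> (\<Sum>i\<in>(UNIV :: 'd set). l)"
  proof (rule sum_mono)
    fix i
    show "\<bar>(x - y) $ i\<bar> \<le> l"
      using assms(1)[of i] assms(2,3) by (auto simp: mem_box_cart abs_le_iff) (smt (verit))+
  qed
  finally show ?thesis
    using assms(4) by (simp add: field_simps)
qed

text \<open>Widening a cube of side \<open>l\<close> by \<open>\<eta>\<close> on every side
  multiplies its volume by \<open>(1 + 2 * \<eta> / l) ^ CARD('d)\<close>. For
  \<open>l \<ge> c\<close> this is largest at \<open>l = c\<close>, so a single
  \<open>\<eta>\<close> suits all these cubes.\<close>

lemma enlarged_cube:
  fixes c \<epsilon> :: real
  assumes "c > 0" "\<epsilon> > 0"
  obtains \<eta> where "\<eta> > 0"
    "\<And>(a :: real ^ 'd) b l. (\<And>i. b $ i - a $ i = l) \<Longrightarrow> c \<le> l \<Longrightarrow>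
      \<exists>U\<in>lmeasurable. (\<forall>x\<in>cbox a b. ball x \<eta> \<subseteq> U) \<and>
        measure lebesgue (U - cbox a b) \<le> \<epsilon> * measure lebesgue (cbox a b)"
proof -
  \<comment> \<open>The growth factor in the worst case \<open>l = c\<close> tends to 1, hence is
    below \<open>1 + \<epsilon>\<close> for some positive \<open>\<eta>\<close>.\<close>
  have "((\<lambda>\<eta>. (1 + 2 * \<eta> / c) ^ CARD('d)) \<longlongrightarrow> (1 + 2 * 0 / c) ^ CARD('d)) (at_right 0)"
    using assms(1) by (intro tendsto_intros) auto
  then have "\<forall>\<^sub>F \<eta> in at_right 0. (1 + 2 * \<eta> / c) ^ CARD('d) < 1 + \<epsilon>"
    by (rule order_tendstoD) (use assms(2) in simp)
  with eventually_at_right_less[of "0::real"]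
  have "\<forall>\<^sub>F \<eta> in at_right 0. (1 + 2 * \<eta> / c) ^ CARD('d) < 1 + \<epsilon> \<and> \<eta> > 0"
    by eventually_elim auto
  then obtain \<eta> where \<eta>: "(1 + 2 * \<eta> / c) ^ CARD('d) < 1 + \<epsilon>" "\<eta> > 0"
    using eventually_happens'[of "at_right (0::real)"] by auto
  show ?thesis
  proof (rule that[OF \<eta>(2)])
    fix a b :: "real ^ 'd" and l
    assume ab: "\<And>i. b $ i - a $ i = l" and "c \<le> l"
    define a' b' where "a' = (\<chi> i. a $ i - \<eta>)" and "b' = (\<chi> i. b $ i + \<eta>)"
    have l: "l > 0" using assms(1) \<open>c \<le> l\<close> by simp
    have ba: "a $ i \<le> b $ i" for i
      using ab[of i] l by linarith
    have "a' $ i \<le> b' $ i" for i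
      unfolding a'_def b'_def using \<eta>(2) ba[of i] by simp
    with ba have ne: "cbox a b \<noteq> {}" "cbox a' b' \<noteq> {}"
      by (simp_all add: interval_eq_empty_cart not_less)
    have side: "b' $ i - a' $ i = l + 2 * \<eta>" for i
      using ab[of i] by (simp add: a'_def b'_def)
    have meas: "measure lebesgue (cbox a b) = l ^ CARD('d)"
      "measure lebesgue (cbox a' b') = (l + 2 * \<eta>) ^ CARD('d)"
      using ne by (simp_all add: content_cbox_cart ab side)
    have sub: "ball x \<eta> \<subseteq> cbox a' b'" if x: "x \<in> cbox a b" for x
    proof
      fix y assume "y \<in> ball x \<eta>"
      then have "norm (x - y) \<le> \<eta>" by (simp add: dist_norm)
      then have "\<bar>(x - y) $ i\<bar> \<le> \<eta>" for i
        by (rule norm_bound_component_le_cart)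
      then have "\<bar>x $ i - y $ i\<bar> \<le> \<eta>" for i by simp
      moreover have "a $ i \<le> x $ i" "x $ i \<le> b $ i" for i
        using x by (auto simp: mem_box_cart)
      ultimately have "a $ i - \<eta> \<le> y $ i \<and> y $ i \<le> b $ i + \<eta>" for i
        by (smt (verit))
      then show "y \<in> cbox a' b'"
        by (auto simp: mem_box_cart a'_def b'_def)
    qed
    have "l + 2 * \<eta> \<le> l * (1 + 2 * \<eta> / c)"
      using \<eta>(2) \<open>c \<le> l\<close> assms(1) by (simp add: field_simps)
    then have "(l + 2 * \<eta>) ^ CARD('d) \<le> (l * (1 + 2 * \<eta> / c)) ^ CARD('d)"
      using l \<eta>(2) by (intro power_mono) auto
    also have "\<dots> \<le> l ^ CARD('d) * (1 + \<epsilon>)"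
      unfolding power_mult_distrib using \<eta>(1) l by (intro mult_left_mono) auto
    finally have le: "(l + 2 * \<eta>) ^ CARD('d) \<le> l ^ CARD('d) * (1 + \<epsilon>)" .
    have "cbox a b \<subseteq> cbox a' b'"
      using sub \<eta>(2) centre_in_ball by blast
    then have "measure lebesgue (cbox a' b' - cbox a b) = (l + 2 * \<eta>) ^ CARD('d) - l ^ CARD('d)"
      using meas by (simp add: measurable_measure_Diff)
    then have "measure lebesgue (cbox a' b' - cbox a b) \<le> \<epsilon> * measure lebesgue (cbox a b)"
      using le meas by (simp add: algebra_simps)
    with sub show "\<exists>U\<in>lmeasurable. (\<forall>x\<in>cbox a b. ball x \<eta> \<subseteq> U) \<and>
        measure lebesgue (U - cbox a b) \<le> \<epsilon> * measure lebesgue (cbox a b)"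
      by blast
  qed
qed

section \<open>Improving a pair: first for compact sets, then in general\<close>

text \<open>The bounds in \<open>big\<close> imply the size condition of the given pair for
  \<open>E \<union> A\<close> and \<open>F\<close>, where \<open>A\<close> is a part of
  \<open>S\<close> of relative measure \<open>\<theta>\<close>. Compactness separates
  \<open>F\<close> from \<open>E \<union> S\<close>, which allows the scale of \<open>A\<close> to
  be fixed before the cube is known.\<close>

lemma John_Stromberg_pair_improve_compact:
  fixes Q E F S :: "(real ^ 'd) set"
  assumes JS: "John_Stromberg_pair (cubes :: (real ^ 'd) set set) (\<tau>, s)"
    and \<theta>: "0 < \<theta>" "\<theta> < 1" "0 < s - \<theta> * (1 - s)"
    and Q: "Q \<in> cubes"
    and cpt: "compact E" "compact F" "compact S"
    and sub: "E \<subseteq> Q" "F \<subseteq> Q" "S \<subseteq> Q"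
    and disj: "E \<inter> F = {}" "E \<inter> S = {}" "F \<inter> S = {}"
    and big: "measure lebesgue E > \<tau> * (measure lebesgue (Q - E - F) - \<theta> * measure lebesgue S)"
      "measure lebesgue F > \<tau> * (measure lebesgue (Q - E - F) - \<theta> * measure lebesgue S)"
  obtains W where "W \<in> cubes" "W \<subseteq> Q"
    "measure lebesgue (E \<inter> W) \<ge> (s - \<theta> * (1 - s)) * measure lebesgue W"
    "measure lebesgue (F \<inter> W) \<ge> (s - \<theta> * (1 - s)) * measure lebesgue W"
proof -
  define s' where "s' = s - \<theta> * (1 - s)"
  have s: "s > 0" "\<tau> > 0" using JS by (auto simp: John_Stromberg_pair_def)
  have sh: "s \<le> 1/2" by (rule John_Stromberg_pair_le_half[OF JS])
  have lm: "E \<in> lmeasurable" "F \<in> lmeasurable" "S \<in> lmeasurable" "Q \<in> lmeasurable"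
    using cpt cubesE[OF Q] by (auto simp: lmeasurable_compact)
  \<comment> \<open>Separating \<open>F\<close> from all of \<open>E \<union> S\<close> makes
    \<open>\<delta>\<close> independent of \<open>A\<close>, whose construction needs
    \<open>\<eta>\<close> and hence \<open>\<delta>\<close>.\<close>
  obtain \<delta> where \<delta>: "\<delta> > 0" "\<And>x y. x \<in> E \<union> S \<Longrightarrow> y \<in> F \<Longrightarrow> \<delta> \<le> dist x y"
    using separate_compact_closed[of "E \<union> S" F] cpt disj compact_Un compact_imp_closed
    by (metis Int_Un_distrib2 Int_commute Un_empty)
  have c: "\<delta> / CARD('d) > 0" using \<delta>(1) by simp
  \<comment> \<open>The relative error \<open>s'\<close> is exactly what can be absorbed: the final
    estimate becomes \<open>(1 - \<theta>) * s'\<close> against \<open>(1 - \<theta>)\<close> times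
    the share of \<open>E\<close>.\<close>
  obtain \<eta> where \<eta>: "\<eta> > 0"
    "\<And>(a :: real ^ 'd) b l. (\<And>i. b $ i - a $ i = l) \<Longrightarrow> \<delta> / CARD('d) \<le> l \<Longrightarrow>
      \<exists>U\<in>lmeasurable. (\<forall>x\<in>cbox a b. ball x \<eta> \<subseteq> U) \<and>
        measure lebesgue (U - cbox a b) \<le> s' * measure lebesgue (cbox a b)"
    using enlarged_cube[OF c, of s'] \<theta>(3) unfolding s'_def by metis
  obtain A where A: "A \<subseteq> S" "A \<in> lmeasurable" "measure lebesgue A = \<theta> * measure lebesgue S"
    "\<And>W U. W \<in> lmeasurable \<Longrightarrow> U \<in> lmeasurable \<Longrightarrow> (\<And>x. x \<in> W \<Longrightarrow> ball x \<eta> \<subseteq> U) \<Longrightarrow>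
      measure lebesgue (A \<inter> W) \<le> \<theta> * measure lebesgue (S \<inter> U)"
    using equidistributed_subset[OF compact_imp_bounded[OF cpt(3)] lm(3) _ _ \<eta>(1), of \<theta>] \<theta> by auto
  have "Q - (E \<union> A) - F = Q - E - F - A" by auto
  moreover have "measure lebesgue (Q - E - F - A) = measure lebesgue (Q - E - F) - measure lebesgue A"
    using lm A sub disj by (intro measurable_measure_Diff) auto
  ultimately have rest: "measure lebesgue (Q - (E \<union> A) - F) = measure lebesgue (Q - E - F) - \<theta> * measure lebesgue S"
    using A(3) by simp
  have "measure lebesgue E \<le> measure lebesgue (E \<union> A)"
    using lm A by (intro measure_mono_fmeasurable) auto
  with big(1) have bigA: "measure lebesgue (E \<union> A) > \<tau> * (measure lebesgue (Q - E - F) - \<theta> * measure lebesgue S)"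
    by linarith
  obtain W where W: "W \<in> cubes" "W \<subseteq> Q"
    "measure lebesgue ((E \<union> A) \<inter> W) \<ge> s * measure lebesgue W" "measure lebesgue (F \<inter> W) \<ge> s * measure lebesgue W"
  proof (rule John_Stromberg_pairD[OF JS Q, of "E \<union> A" F, unfolded rest])
    show "E \<union> A \<subseteq> Q" "(E \<union> A) \<inter> F = {}" using A(1) sub disj by auto
  qed (use lm A sub big(2) bigA in auto)
  obtain a b l where l: "W = cbox a b" "l > 0" "\<And>i. b $ i - a $ i = l" "measure lebesgue W = l ^ CARD('d)"
    using cubesE[OF W(1)] by metis
  have w: "measure lebesgue W > 0" "W \<in> lmeasurable" using l by auto
  \<comment> \<open>Both intersections have positive measure, so \<open>W\<close> contains a point
    of \<open>E \<union> A\<close> and one of \<open>F\<close>; this bounds its side from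
    below.\<close>
  then have "s * measure lebesgue W > 0" using s by simp
  then have "measure lebesgue ((E \<union> A) \<inter> W) \<noteq> 0" "measure lebesgue (F \<inter> W) \<noteq> 0"
    using W by linarith+
  then have "(E \<union> A) \<inter> W \<noteq> {}" "F \<inter> W \<noteq> {}"
    by (metis measure_empty)+
  then obtain x y where xy: "x \<in> E \<union> A" "x \<in> W" "y \<in> F" "y \<in> W" by auto
  have "\<delta> / CARD('d) \<le> l"
    by (rule cube_meeting_separated_sets[OF l(3), of x y]) (use xy l(1) \<delta>(2) A(1) in auto)
  then obtain U where U: "U \<in> lmeasurable" "\<And>x. x \<in> W \<Longrightarrow> ball x \<eta> \<subseteq> U"
    "measure lebesgue (U - W) \<le> s' * measure lebesgue W"
    using \<eta>(2)[OF l(3)] l(1) by auto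
  have "W \<subseteq> U" using U(2) \<eta>(1) centre_in_ball by blast
  have "measure lebesgue (S \<inter> U) \<le> measure lebesgue ((S \<inter> W) \<union> (U - W))"
    using lm U w by (intro measure_mono_fmeasurable) auto
  also have "\<dots> \<le> measure lebesgue (S \<inter> W) + measure lebesgue (U - W)"
    using lm U w by (intro measure_Un_le) auto
  also have "measure lebesgue (S \<inter> W) \<le> measure lebesgue W - measure lebesgue (E \<inter> W) - measure lebesgue (F \<inter> W)"
  proof -
    have "measure lebesgue (S \<inter> W) + measure lebesgue (E \<inter> W) + measure lebesgue (F \<inter> W)
      = measure lebesgue ((S \<inter> W) \<union> (E \<inter> W)) + measure lebesgue (F \<inter> W)"
      using lm w disj by (subst measure_Un_AE) auto
    also have "\<dots> = measure lebesgue ((S \<inter> W) \<union> (E \<inter> W) \<union> (F \<inter> W))"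
      using lm w disj by (subst measure_Un_AE[where A = "(S \<inter> W) \<union> (E \<inter> W)"]) auto
    also have "\<dots> \<le> measure lebesgue W"
      using lm w by (intro measure_mono_fmeasurable) auto
    finally show ?thesis by simp
  qed
  \<comment> \<open>Here \<open>- s\<close> comes from the share of \<open>F\<close> in
    \<open>W\<close>, and \<open>s'\<close> from the part of \<open>U\<close> outside
    \<open>W\<close>.\<close>
  finally have SU: "measure lebesgue (S \<inter> U) \<le>
      (1 - s + s') * measure lebesgue W - measure lebesgue (E \<inter> W)"
    using U(3) W(4) by (simp add: algebra_simps)
  have "s * measure lebesgue W \<le> measure lebesgue (E \<inter> W) + measure lebesgue (A \<inter> W)"
    using W(3) measure_Un_le[of "E \<inter> W" lebesgue "A \<inter> W"] lm A w
    by (simp add: Int_Un_distrib2)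
  also have "measure lebesgue (A \<inter> W) \<le> \<theta> * measure lebesgue (S \<inter> U)"
    using A(4)[OF w(2) U(1,2)] .
  also have "\<dots> \<le> \<theta> * ((1 - s + s') * measure lebesgue W - measure lebesgue (E \<inter> W))"
    using SU \<theta> by (intro mult_left_mono) auto
  finally have "(1 - \<theta>) * (s' * measure lebesgue W) \<le> (1 - \<theta>) * measure lebesgue (E \<inter> W)"
    by (simp add: s'_def algebra_simps)
  then have 1: "s' * measure lebesgue W \<le> measure lebesgue (E \<inter> W)"
    using \<theta> by simp
  \<comment> \<open>For \<open>F\<close> the original constant \<open>s\<close> survives, and
    \<open>s \<le> 1/2\<close> makes the subtracted term nonnegative.\<close>
  have "s' \<le> s" using \<theta> sh by (simp add: s'_def)
  then have "s' * measure lebesgue W \<le> s * measure lebesgue W"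
    using w by (intro mult_right_mono) auto
  then have 2: "s' * measure lebesgue W \<le> measure lebesgue (F \<inter> W)"
    using W(4) by linarith
  show ?thesis
    using that[OF W(1,2)] 1 2 unfolding s'_def by blast
qed

text \<open>The strict size condition leaves a gap that pays for replacing \<open>E\<close>,
  \<open>F\<close> and the enlarged remainder by compact subsets. A cube that works for the smaller
  sets works for \<open>E\<close> and \<open>F\<close> by monotonicity.\<close>

lemma John_Stromberg_pair_improve:
  fixes \<tau> s \<theta> :: real
  assumes JS: "John_Stromberg_pair (cubes :: (real ^ 'd) set set) (\<tau>, s)"
    and \<theta>: "0 < \<theta>" "\<theta> < 1" "0 < s - \<theta> * (1 - s)"
  shows "John_Stromberg_pair (cubes :: (real ^ 'd) set set) ((1 - \<theta>) * \<tau>, s - \<theta> * (1 - s))"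
proof -
  have s: "s > 0" "\<tau> > 0" using JS by (auto simp: John_Stromberg_pair_def)
  have "\<exists>W\<in>cubes. W \<subseteq> Q \<and>
      (s - \<theta> * (1 - s)) * measure lebesgue W \<le> min (measure lebesgue (E \<inter> W)) (measure lebesgue (F \<inter> W))"
    if Q: "Q \<in> cubes" and m: "E \<in> sets lebesgue" "F \<in> sets lebesgue"
      and sub: "E \<subseteq> Q" "F \<subseteq> Q" and disj: "E \<inter> F = {}"
      and big: "min (measure lebesgue E) (measure lebesgue F) > (1 - \<theta>) * \<tau> * measure lebesgue (Q - E - F)"
    for Q E F :: "(real ^ 'd) set"
  proof -
    have Qb: "bounded Q" "Q \<in> lmeasurable"
      using cubesE[OF Q] by (metis bounded_cbox lmeasurable_cbox)+
    have bd: "bounded E" "bounded F" using sub Qb bounded_subset by auto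
    have lm: "E \<in> lmeasurable" "F \<in> lmeasurable"
      using bd m by (auto intro: bounded_set_imp_lmeasurable)
    define r where "r = measure lebesgue (Q - E - F)"
    \<comment> \<open>The gap is divided into \<open>1 + 2 * \<tau>\<close> shares: one for the loss
      in \<open>E\<close> or \<open>F\<close>, and \<open>2 * \<tau>\<close> for the growth of the
      remainder, multiplied by \<open>\<tau>\<close>.\<close>
    define e where "e = (min (measure lebesgue E) (measure lebesgue F) - (1 - \<theta>) * \<tau> * r) / (1 + 2 * \<tau>)"
    have e: "e > 0" using big s by (simp add: e_def r_def)
    have gap: "min (measure lebesgue E) (measure lebesgue F) = (1 - \<theta>) * \<tau> * r + e * (1 + 2 * \<tau>)"
      using s by (simp add: e_def)
    obtain E' where E': "compact E'" "E' \<subseteq> E" "measure lebesgue E - e < measure lebesgue E'"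
      using lmeasurable_inner_compact[OF bd(1) m(1) e] .
    obtain F' where F': "compact F'" "F' \<subseteq> F" "measure lebesgue F - e < measure lebesgue F'"
      using lmeasurable_inner_compact[OF bd(2) m(2) e] .
    have lm': "E' \<in> lmeasurable" "F' \<in> lmeasurable"
      using E' F' by (auto intro: lmeasurable_compact)
    define G where "G = Q - E' - F'"
    have G: "bounded G" "G \<in> sets lebesgue"
      using Qb lm' by (auto simp: G_def intro: bounded_subset)
    obtain S where S: "compact S" "S \<subseteq> G" "measure lebesgue G - e < measure lebesgue S"
      using lmeasurable_inner_compact[OF G e] .
    have "measure lebesgue G \<le> measure lebesgue ((Q - E - F) \<union> (E - E') \<union> (F - F'))"
      using Qb lm lm' by (intro measure_mono_fmeasurable) (auto simp: G_def)
    also have "\<dots> \<le> measure lebesgue ((Q - E - F) \<union> (E - E')) + measure lebesgue (F - F')"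
      using Qb lm lm' by (intro measure_Un_le) auto
    also have "measure lebesgue ((Q - E - F) \<union> (E - E')) \<le> r + measure lebesgue (E - E')"
      unfolding r_def using Qb lm lm' by (intro measure_Un_le) auto
    also have "measure lebesgue (E - E') < e"
      using E' lm lm' by (simp add: measurable_measure_Diff)
    also have "measure lebesgue (F - F') < e"
      using F' lm lm' by (simp add: measurable_measure_Diff)
    finally have "measure lebesgue G < r + 2 * e" by simp
    then have "(1 - \<theta>) * measure lebesgue G \<le> (1 - \<theta>) * (r + 2 * e)"
      using \<theta> by (intro mult_left_mono) auto
    moreover have "\<theta> * (measure lebesgue G - e) \<le> \<theta> * measure lebesgue S"
      using S(3) \<theta> by (intro mult_left_mono) auto
    \<comment> \<open>The errors add up to \<open>(1 - \<theta>) * 2 * e + \<theta> * e\<close>,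
      that is \<open>2 * e - \<theta> * e\<close>, which stays below \<open>2 * e\<close>.\<close>
    moreover have "\<theta> * e > 0" using \<theta> e by simp
    ultimately have "measure lebesgue G - \<theta> * measure lebesgue S \<le> (1 - \<theta>) * r + 2 * e"
      by (simp add: algebra_simps)
    then have "\<tau> * (measure lebesgue G - \<theta> * measure lebesgue S) \<le> \<tau> * ((1 - \<theta>) * r + 2 * e)"
      using s by (intro mult_left_mono) auto
    also have "\<dots> = min (measure lebesgue E) (measure lebesgue F) - e"
      unfolding gap by (simp add: algebra_simps)
    finally have *: "\<tau> * (measure lebesgue G - \<theta> * measure lebesgue S) < measure lebesgue E'"
       "\<tau> * (measure lebesgue G - \<theta> * measure lebesgue S) < measure lebesgue F'"
      using E'(3) F'(3) by linarith+
    have "E' \<subseteq> Q" "F' \<subseteq> Q" "S \<subseteq> Q" "E' \<inter> F' = {}" "E' \<inter> S = {}" "F' \<inter> S = {}"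
      using E'(2) F'(2) S(2) sub disj by (auto simp: G_def)
    then obtain W where W: "W \<in> cubes" "W \<subseteq> Q"
      "measure lebesgue (E' \<inter> W) \<ge> (s - \<theta> * (1 - s)) * measure lebesgue W"
      "measure lebesgue (F' \<inter> W) \<ge> (s - \<theta> * (1 - s)) * measure lebesgue W"
      using John_Stromberg_pair_improve_compact[OF JS \<theta> Q E'(1) F'(1) S(1)] *[unfolded G_def]
      by metis
    have "W \<in> lmeasurable" using cubesE[OF W(1)] by (metis lmeasurable_cbox)
    then have "measure lebesgue (E' \<inter> W) \<le> measure lebesgue (E \<inter> W)"
      "measure lebesgue (F' \<inter> W) \<le> measure lebesgue (F \<inter> W)"
      using E'(2) F'(2) lm lm' by (auto intro!: measure_mono_fmeasurable)
    with W show ?thesis by (intro bexI[of _ W]) auto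
  qed
  then show ?thesis
    using \<theta> s unfolding John_Stromberg_pair_def by auto
qed

theorem theorem4p1:
  fixes \<tau> s :: real
  assumes "John_Stromberg_pair (cubes :: (real ^ 'd) set set) (\<tau>, s)"
  shows "0 < s \<and> s \<le> 1 / 2 \<and>
    (\<forall>\<theta>\<in>{0<..<s / (1 - s)}.
       John_Stromberg_pair (cubes :: (real ^ 'd) set set) ((1 - \<theta>) * \<tau>, s - \<theta> * (1 - s)))"
proof (intro conjI ballI)
  show s: "0 < s"
    using assms by (simp add: John_Stromberg_pair_def)
  show sh: "s \<le> 1 / 2"
    by (rule John_Stromberg_pair_le_half[OF assms])
  fix \<theta> assume \<theta>: "\<theta> \<in> {0<..<s / (1 - s)}"
  then have "0 < s - \<theta> * (1 - s)"
    using sh by (simp add: field_simps)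
  \<comment> \<open>This is where \<open>s \<le> 1/2\<close> yields \<open>\<theta> < 1\<close>, so
    that \<open>(1 - \<theta>) * \<tau>\<close> is positive.\<close>
  moreover have "s / (1 - s) \<le> 1"
    using sh by simp
  ultimately show "John_Stromberg_pair (cubes :: (real ^ 'd) set set) ((1 - \<theta>) * \<tau>, s - \<theta> * (1 - s))"
    using \<theta> by (intro John_Stromberg_pair_improve[OF assms]) auto
qed

end
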